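(* Let $G$ be a finite group which is not an EPPO-group. Then the following conditions are equivalent: (i) the difference graph $\mathcal{D}(G)$ is a star graph; (ii) $\mathcal{D}(G)$ is dominatable; (iii) $G$ satisfies condition $\mathcal{B}$.
   Context: A finite group $G$ is an EPPO-group if the order of each element of $G$ is a prime power (the identity, of order $1$, being allowed). Difference graph: the power graph $\mathcal{P}(G)$ is the simple undirected graph with vertex set $G$ in which distinct $a,b$ are adjacent iff $a\in\langle b\rangle$ or $b\in\langle a\rangle$. The enhanced power graph $\mathcal{P}_E(G)$ is the simple undirected graph with vertex set $G$ in which distinct $a,b$ are adjacent iff $a,b\in\langle c\rangle$ for some $c\in G$. The difference graph $\mathcal{D}(G)$ is obtained from the graph $\mathcal{P}_E(G)-\mathcal{P}(G)$ (vertex set $G$; two vertices are adjacent iff they are adjacent in $\mathcal{P}_E(G)$ but not in $\mathcal{P}(G)$) by removing all isolated vertices. Condition $\mathcal{B}$: there are primes $p_1,\dots,p_k>2$ such that the order of every element of $G$ is $1$, or one of $2p_1,\dots,2p_k$, or of the form $p^{\alpha}$ with $p$ a prime and $\alpha\in\mathbb{N}$; and for all $1\le i,j\le k$ (possibly $i=j$), the intersection of any two distinct cyclic subgroups of $G$ of orders $2p_i$ and $2p_j$ respectively has cardinality exactly $2$. A star graph is a complete bipartite graph $K_{1,n}$. A graph is dominatable if it has a dominating vertex, i.e. a vertex adjacent to all the other vertices. *)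

theory Defs
  imports
    "HOL-Algebra.Multiplicative_Group"
    "HOL-Computational_Algebra.Primes"
    "Graph_Theory.Kuratowski"
begin

text \<open>Undirected simple graphs are represented, as in the AFP entry on graph theory, by symmetric
  loop-free sets of ordered pairs.\<close>

definition EPPO_group :: "('a, 'b) monoid_scheme \<Rightarrow> bool" where
  "EPPO_group G \<longleftrightarrow> group G \<and> finite (carrier G) \<and>
     (\<forall>x\<in>carrier G. \<exists>(p::nat) \<alpha>. prime p \<and> group.ord G x = p ^ \<alpha>)"

definition power_graph :: "('a, 'b) monoid_scheme \<Rightarrow> 'a pair_pre_digraph" where
  "power_graph G = \<lparr> pverts = carrier G,
     parcs = {(a, b). a \<in> carrier G \<and> b \<in> carrier G \<and> a \<noteq> b \<and>
                      (a \<in> generate G {b} \<or> b \<in> generate G {a})} \<rparr>"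

definition enhanced_power_graph :: "('a, 'b) monoid_scheme \<Rightarrow> 'a pair_pre_digraph" where
  "enhanced_power_graph G = \<lparr> pverts = carrier G,
     parcs = {(a, b). a \<in> carrier G \<and> b \<in> carrier G \<and> a \<noteq> b \<and>
                      (\<exists>c\<in>carrier G. a \<in> generate G {c} \<and> b \<in> generate G {c})} \<rparr>"

definition isolated_vertex :: "'a pair_pre_digraph \<Rightarrow> 'a \<Rightarrow> bool" where
  "isolated_vertex H v \<longleftrightarrow> v \<in> pverts H \<and> (\<forall>w. (v, w) \<notin> parcs H \<and> (w, v) \<notin> parcs H)"

text \<open>Deleting isolated vertices deletes no arc.\<close>

definition remove_isolated :: "'a pair_pre_digraph \<Rightarrow> 'a pair_pre_digraph" where
  "remove_isolated H = \<lparr> pverts = {v \<in> pverts H. \<not> isolated_vertex H v}, parcs = parcs H \<rparr>"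

definition difference_graph :: "('a, 'b) monoid_scheme \<Rightarrow> 'a pair_pre_digraph" where
  "difference_graph G = remove_isolated
     \<lparr> pverts = carrier G, parcs = parcs (enhanced_power_graph G) - parcs (power_graph G) \<rparr>"

lemma (in group) pair_graph_difference_graph:
  assumes "finite (carrier G)"
  shows "pair_graph (difference_graph G)"
proof -
  have "parcs (difference_graph G) \<subseteq> carrier G \<times> carrier G"
    by (auto simp: difference_graph_def remove_isolated_def enhanced_power_graph_def)
  then have "finite (parcs (difference_graph G))"
    using assms finite_subset by blast
  then show ?thesis
    using assms
    by unfold_locales
       (auto simp: difference_graph_def remove_isolated_def isolated_vertex_def symmetric_def
         enhanced_power_graph_def power_graph_def intro!: symI)
qed

text \<open>As usual for complete bipartite graphs, both parts are nonempty.\<close>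

definition star_graph :: "'a pair_pre_digraph \<Rightarrow> bool" where
  "star_graph H \<longleftrightarrow> (\<exists>n\<ge>1. complete_bipartite_digraph 1 n (with_proj H))"

definition dominating_vertex :: "'a pair_pre_digraph \<Rightarrow> 'a \<Rightarrow> bool" where
  "dominating_vertex H v \<longleftrightarrow> v \<in> pverts H \<and> (\<forall>w\<in>pverts H. w \<noteq> v \<longrightarrow> (v, w) \<in> parcs H)"

definition dominatable :: "'a pair_pre_digraph \<Rightarrow> bool" where
  "dominatable H \<longleftrightarrow> (\<exists>v. dominating_vertex H v)"

definition cyclic_subgroup :: "('a, 'b) monoid_scheme \<Rightarrow> 'a set \<Rightarrow> bool" where
  "cyclic_subgroup G H \<longleftrightarrow> (\<exists>x\<in>carrier G. H = generate G {x})"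

text \<open>The set \<open>P\<close> is the family \<open>p\<^sub>1, \<dots>, p\<^sub>k\<close>; a prime in \<open>P\<close> need not be realised by an
  element of order \<open>2p\<close>.\<close>

definition condition_B :: "('a, 'b) monoid_scheme \<Rightarrow> bool" where
  "condition_B G \<longleftrightarrow> (\<exists>P::nat set. finite P \<and> P \<noteq> {} \<and> (\<forall>p\<in>P. prime p \<and> p > 2) \<and>
     (\<forall>x\<in>carrier G. group.ord G x = 1 \<or> (\<exists>p\<in>P. group.ord G x = 2 * p) \<or>
        (\<exists>(p::nat) \<alpha>. prime p \<and> group.ord G x = p ^ \<alpha>)) \<and>
     (\<forall>p\<in>P. \<forall>q\<in>P. \<forall>H K. cyclic_subgroup G H \<and> card H = 2 * p \<and>
        cyclic_subgroup G K \<and> card K = 2 * q \<and> H \<noteq> K \<longrightarrow> card (H \<inter> K) = 2))"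

end

theory Submission
  imports Defs
begin

text \<open>Inside a cyclic group the subgroups are ordered by divisibility of their orders, so \<open>a\<close> and \<open>b\<close>
  are adjacent in the difference graph iff they lie in a common cyclic subgroup and neither order
  divides the other. A dominating vertex \<open>v\<close> is not adjacent to \<open>v\<inverse>\<close>, so it is an involution, and
  all other vertices have odd order. Hence an element whose order is not a prime power has
  order \<open>2p\<close> and its unique involution is \<open>v\<close>; this gives condition B. Conversely,
  condition B forces all elements of order \<open>2p\<close> to share one involution \<open>v\<close>, and every edge of the
  difference graph joins \<open>v\<close> to an element of odd prime order.\<close>

section \<open>Divisors of prime powers and of \<open>2 * p\<close>\<close>

text \<open>After the full \<open>p\<close>-part of \<open>n\<close> is split off, the cofactor
  \<open>m\<close> cannot be 1, since \<open>n\<close> would then be a power of \<open>p\<close>;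
  any prime factor of \<open>m\<close> is the second prime.\<close>

lemma not_prime_power_imp_two_primes:
  fixes n :: nat
  assumes "n > 0" and "\<nexists>p k. prime p \<and> n = p ^ k"
  obtains p q :: nat where "prime p" "prime q" "p \<noteq> q" "p dvd n" "q dvd n"
proof -
  have "n \<noteq> 1"
    using assms(2) two_is_prime_nat power_0 by metis
  then obtain p where p: "prime p" "p dvd n"
    using prime_factor_nat by blast
  obtain m where m: "n = p ^ multiplicity p n * m" "\<not> p dvd m"
    using multiplicity_decompose'[of n p] assms(1) p by (metis not_prime_unit less_irrefl)
  have "m \<noteq> 1"
    using m(1) p(1) assms(2) by (metis mult.right_neutral)
  then obtain q where q: "prime q" "q dvd m"
    using prime_factor_nat by blast
  have "q dvd n"
    using m(1) q(2) by (metis dvd_mult)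
  moreover have "p \<noteq> q"
    using m(2) q(2) by blast
  ultimately show thesis
    using that p q by blast
qed

lemma dvd_comparable_prime_power:
  fixes m k n p :: nat
  assumes "prime p" "n = p ^ e" "m dvd n" "k dvd n"
  shows "m dvd k \<or> k dvd m"
proof -
  obtain i j where "m = p ^ i" "k = p ^ j"
    using assms by (meson divides_primepow_nat)
  then show ?thesis
    by (metis le_imp_power_dvd nat_le_linear)
qed

text \<open>Among the divisors 1, 2, \<open>p\<close>, \<open>2 * p\<close> only 2 and
  \<open>p\<close> can be incomparable. Thus an arc inside a cyclic group of order
  \<open>2 * p\<close> must end in an involution.\<close>

lemma dvd_two_times_prime_incomparable:
  fixes m k p :: nat
  assumes p: "prime p" and dvd: "m dvd 2 * p" "k dvd 2 * p" and inc: "\<not> m dvd k" "\<not> k dvd m"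
  shows "m = 2 \<or> k = 2"
proof -
  have D: "d = 1 \<or> d = 2 \<or> d = p \<or> d = 2 * p" if d: "d dvd 2 * p" for d
  proof -
    obtain a b where d: "d = a * b" "a dvd 2" "b dvd p"
      using d division_decomp[of d 2 p] by blast
    then have "a = 1 \<or> a = 2" "b = 1 \<or> b = p"
      using p two_is_prime_nat by (meson prime_nat_iff)+
    then show ?thesis
      using d(1) by auto
  qed
  show ?thesis
    using D[OF dvd(1)] D[OF dvd(2)] inc dvd by auto
qed

lemma card_2_other_element:
  assumes "card A = 2" "x \<in> A"
  obtains y where "A = {x, y}" "y \<noteq> x"
proof -
  obtain a b where "A = {a, b}" "a \<noteq> b"
    using assms(1) by (auto simp: card_2_iff)
  then show thesis
    using assms(2) that[of a] that[of b] by auto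
qed

section \<open>Orders of elements in a cyclic group\<close>

context group
begin

lemma ord_dvd_if_mem_generate:
  assumes "b \<in> carrier G" "a \<in> generate G {b}"
  shows "ord a dvd ord b"
proof -
  obtain k :: int where a: "a = b [^] k"
    using assms generate_pow by blast
  have "a [^] ord b = b [^] (k * int (ord b))"
    using a assms(1) by (simp add: int_pow_int[symmetric] int_pow_pow)
  also have "\<dots> = \<one>"
    using assms(1) by (simp add: int_pow_eq_id)
  finally show ?thesis
    using a assms(1) pow_eq_id by simp
qed

lemma nat_pow_mem_generate:
  assumes "x \<in> carrier G"
  shows "x [^] (n::nat) \<in> generate G {x}"
  unfolding generate_pow[OF assms] using int_pow_int[of G x n, symmetric] by blast

text \<open>Write \<open>a\<close> and \<open>b\<close> as the powers of \<open>c\<close> with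
  exponents \<open>i\<close> and \<open>j\<close>. The order of \<open>b\<close> is
  \<open>ord c div g\<close> with \<open>g\<close> the gcd of \<open>j\<close> and
  \<open>ord c\<close>, so the divisibility of the orders forces \<open>g\<close> to divide
  \<open>i\<close>. Scaling a Bezout identity for \<open>g\<close> then shows that \<open>i\<close>
  is a multiple of \<open>j\<close> modulo \<open>ord c\<close>.\<close>

lemma mem_generate_if_ord_dvd:
  assumes fin: "finite (carrier G)" and c: "c \<in> carrier G"
    and a: "a \<in> generate G {c}" and b: "b \<in> generate G {c}" and dvd: "ord a dvd ord b"
  shows "a \<in> generate G {b}"
proof -
  obtain i j :: nat where i: "a = c [^] i" and j: "b = c [^] j"
    using a b generate_pow_on_finite_carrier[OF fin c] by blast
  have n: "ord c > 0"
    using ord_ge_1[OF fin c] by simp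
  have "c [^] (i * ord b) = \<one>"
    using dvd c i pow_eq_id[of a] by (simp add: nat_pow_pow)
  then have *: "ord c dvd i * ord b"
    using c pow_eq_id by blast
  define g where "g = gcd j (ord c)"
  have g: "g > 0" "g dvd ord c"
    using n by (auto simp: g_def)
  have "ord b = ord c div g"
    using ord_pow_gen[OF c, of j] n by (auto simp: j g_def gcd.commute)
  then have "g dvd i"
    using * g n by (metis dvd_div_mult_self dvd_mult_cancel_right dvd_times_right_cancel_iff
        mult.commute not_gr_zero mult_eq_0_iff)
  then obtain t where t: "i = g * t"
    by blast
  obtain u w :: int where uw: "u * int j + w * int (ord c) = int g"
    using bezout_int[of "int j" "int (ord c)"] by (auto simp: g_def)
  have "int i = int j * (u * int t) + int (ord c) * (w * int t)"
    using arg_cong[OF uw, of "\<lambda>z. z * int t"] by (simp add: t algebra_simps)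
  then have "c [^] int i = c [^] (int j * (u * int t))"
    using c by (simp add: int_pow_eq)
  then have "a = b [^] (u * int t)"
    using c by (simp add: i j int_pow_int[symmetric] int_pow_pow)
  then show ?thesis
    using generate_pow[of b] j c by auto
qed

section \<open>Arcs and vertices of the difference graph in terms of orders\<close>

lemma difference_graph_arc_iff:
  assumes "finite (carrier G)"
  shows "(a, b) \<in> parcs (difference_graph G) \<longleftrightarrow>
    (\<exists>c\<in>carrier G. a \<in> generate G {c} \<and> b \<in> generate G {c} \<and>
       \<not> ord a dvd ord b \<and> \<not> ord b dvd ord a)" (is "?L \<longleftrightarrow> ?R")
proof
  assume ?L
  then have ab: "a \<in> carrier G" "b \<in> carrier G" "a \<notin> generate G {b}" "b \<notin> generate G {a}"
    and "\<exists>c\<in>carrier G. a \<in> generate G {c} \<and> b \<in> generate G {c}"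
    by (auto simp: difference_graph_def remove_isolated_def enhanced_power_graph_def
        power_graph_def)
  then show ?R
    using mem_generate_if_ord_dvd[OF assms] by meson
next
  assume ?R
  then obtain c where c: "c \<in> carrier G" "a \<in> generate G {c}" "b \<in> generate G {c}"
    and ab: "\<not> ord a dvd ord b" "\<not> ord b dvd ord a"
    by blast
  have carr: "a \<in> carrier G" "b \<in> carrier G"
    using c generate_in_carrier[of "{c}"] by auto
  have "a \<notin> generate G {b}"
    using ab(1) ord_dvd_if_mem_generate[OF carr(2)] by metis
  moreover have "b \<notin> generate G {a}"
    using ab(2) ord_dvd_if_mem_generate[OF carr(1)] by metis
  moreover have "a \<noteq> b"
    using ab by auto
  ultimately show ?L
    using c carr
    by (auto simp: difference_graph_def remove_isolated_def enhanced_power_graph_def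
        power_graph_def)
qed

lemma difference_graph_arc_sym:
  assumes "finite (carrier G)" "(a, b) \<in> parcs (difference_graph G)"
  shows "(b, a) \<in> parcs (difference_graph G)"
  using assms by (auto simp: difference_graph_arc_iff)

text \<open>Since the arcs are symmetric, an outgoing arc alone witnesses that a vertex is not
  isolated.\<close>

lemma difference_graph_vertex_iff:
  assumes "finite (carrier G)"
  shows "a \<in> pverts (difference_graph G) \<longleftrightarrow> (\<exists>b. (a, b) \<in> parcs (difference_graph G))"
proof -
  have "a \<in> carrier G" if "(a, b) \<in> parcs (difference_graph G)" for b
    using that by (auto simp: difference_graph_def remove_isolated_def enhanced_power_graph_def)
  moreover have "a \<in> pverts (difference_graph G) \<longleftrightarrow> a \<in> carrier G \<and>
      (\<exists>b. (a, b) \<in> parcs (difference_graph G) \<or> (b, a) \<in> parcs (difference_graph G))"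
    by (auto simp: difference_graph_def remove_isolated_def isolated_vertex_def)
  ultimately show ?thesis
    using difference_graph_arc_sym[OF assms] by metis
qed

lemma ord_pow_div:
  assumes "finite (carrier G)" "x \<in> carrier G" "m dvd ord x"
  shows "ord (x [^] (ord x div m)) = m"
proof -
  obtain k where k: "ord x = m * k"
    using assms(3) by (rule dvdE)
  moreover have "ord x > 0"
    using ord_ge_1[OF assms(1,2)] by simp
  ultimately have "m > 0" "k > 0"
    by simp_all
  then show ?thesis
    using ord_pow[OF assms(2), of k] k by simp
qed

text \<open>This is the source of all concrete arcs: the two powers have orders \<open>m\<close> and
  \<open>k\<close> and lie in the cyclic group generated by \<open>x\<close>.\<close>

lemma difference_graph_arc_powers:
  assumes "finite (carrier G)" "x \<in> carrier G" "m dvd ord x" "k dvd ord x" "\<not> m dvd k" "\<not> k dvd m"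
  shows "(x [^] (ord x div m), x [^] (ord x div k)) \<in> parcs (difference_graph G)"
  unfolding difference_graph_arc_iff[OF assms(1)]
  using assms by (auto simp: ord_pow_div intro!: nat_pow_mem_generate bexI[of _ x])

lemma generate_involution:
  assumes "a \<in> carrier G" "ord a = 2"
  shows "generate G {a} = {\<one>, a}"
proof -
  have "card (generate G {a}) = 2"
    using generate_pow_card assms by metis
  moreover have "\<one> \<in> generate G {a}" "a \<in> generate G {a}" "a \<noteq> \<one>"
    using assms by (auto intro: generate.intros)
  ultimately show ?thesis
    by (auto simp: card_2_iff)
qed

text \<open>Equal orders put \<open>a\<close> into the group generated by \<open>b\<close>, whose
  only nontrivial element is \<open>b\<close>.\<close>

lemma cyclic_unique_involution:
  assumes fin: "finite (carrier G)" and c: "c \<in> carrier G"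
    and a: "a \<in> generate G {c}" "ord a = 2" and b: "b \<in> generate G {c}" "ord b = 2"
  shows "a = b"
proof -
  have "a \<in> generate G {b}"
    using mem_generate_if_ord_dvd[OF fin c a(1) b(1)] a b by simp
  moreover have "b \<in> carrier G"
    using generate_in_carrier[of "{c}"] c b by auto
  ultimately show ?thesis
    using generate_involution a b by auto
qed

section \<open>Element orders in the presence of a dominating vertex\<close>

lemma dominating_vertex_involution:
  assumes fin: "finite (carrier G)" and dom: "dominating_vertex (difference_graph G) v"
  shows "v \<in> carrier G" and "ord v = 2"
proof -
  let ?D = "difference_graph G"
  obtain w where w: "(v, w) \<in> parcs ?D"
    using dom difference_graph_vertex_iff[OF fin] by (auto simp: dominating_vertex_def)
  then obtain c where c: "c \<in> carrier G" "v \<in> generate G {c}" "w \<in> generate G {c}"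
    "\<not> ord v dvd ord w" "\<not> ord w dvd ord v"
    unfolding difference_graph_arc_iff[OF fin] by blast
  show v: "v \<in> carrier G"
    using c generate_in_carrier[of "{c}"] by auto
  \<comment> \<open>The inverse has the order of \<open>v\<close> and lies in the same cyclic group,
    so it inherits the neighbour \<open>w\<close> and is not isolated. Not being adjacent to
    \<open>v\<close>, it must equal \<open>v\<close>.\<close>
  have "inv v \<in> generate G {c}"
    using c generate_m_inv_closed[of "{c}"] by auto
  then have "(inv v, w) \<in> parcs ?D"
    unfolding difference_graph_arc_iff[OF fin] using c v by auto
  moreover have "(v, inv v) \<notin> parcs ?D"
    unfolding difference_graph_arc_iff[OF fin] using v by auto
  ultimately have "inv v = v"
    using dom difference_graph_vertex_iff[OF fin] by (auto simp: dominating_vertex_def)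
  then have "v [^] (2::nat) = \<one>"
    using v by (metis numeral_2_eq_2 nat_pow_Suc nat_pow_0 l_one r_inv)
  then have "ord v dvd 2"
    using v pow_eq_id by simp
  moreover have "ord v \<noteq> 1"
    using c by auto
  ultimately show "ord v = 2"
    using two_is_prime_nat by (auto simp: prime_nat_iff)
qed

lemma difference_graph_vertex_odd:
  assumes fin: "finite (carrier G)" and dom: "dominating_vertex (difference_graph G) v"
    and w: "(w, u) \<in> parcs (difference_graph G)" "w \<noteq> v"
  shows "odd (ord w)"
proof -
  have "(v, w) \<in> parcs (difference_graph G)"
    using dom w difference_graph_vertex_iff[OF fin] by (auto simp: dominating_vertex_def)
  then show ?thesis
    using dominating_vertex_involution[OF fin dom] unfolding difference_graph_arc_iff[OF fin]
    by auto
qed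

text \<open>The power of \<open>x\<close> of order \<open>m\<close> has a neighbour of order
  \<open>k\<close>. As a non-isolated vertex of even order it can only be \<open>v\<close>. Below,
  contradictions come from an even divisor other than 2 that is incomparable to another
  divisor.\<close>

lemma dominating_vertex_even_divisor:
  assumes fin: "finite (carrier G)" and dom: "dominating_vertex (difference_graph G) v"
    and x: "x \<in> carrier G" "m dvd ord x" "k dvd ord x" "\<not> m dvd k" "\<not> k dvd m"
    and "even m"
  shows "m = 2" and "x [^] (ord x div m) = v"
proof -
  have o: "ord (x [^] (ord x div m)) = m"
    by (rule ord_pow_div[OF fin x(1,2)])
  show *: "x [^] (ord x div m) = v"
    using difference_graph_vertex_odd[OF fin dom difference_graph_arc_powers[OF fin x]] o assms(8)
    by auto
  show "m = 2"
    using o * dominating_vertex_involution[OF fin dom] by simp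
qed

lemma cyclic_commute:
  assumes "finite (carrier G)" "c \<in> carrier G" "a \<in> generate G {c}" "b \<in> generate G {c}"
  shows "a \<otimes> b = b \<otimes> a"
proof -
  obtain i j :: nat where "a = c [^] i" "b = c [^] j"
    using assms generate_pow_on_finite_carrier[OF assms(1,2)] by blast
  then show ?thesis
    using assms(2) by (simp add: nat_pow_mult add.commute)
qed

lemma commute_int_pow:
  assumes "finite (carrier G)" "x \<otimes> y = y \<otimes> x" "x \<in> carrier G" "y \<in> carrier G"
  shows "x \<otimes> y [^] (i::int) = y [^] i \<otimes> x"
proof -
  \<comment> \<open>Finiteness trades the integer exponent for a natural one, to which
    \<open>group_commutes_pow\<close> applies.\<close>
  have "y [^] i \<in> generate G {y}"
    using generate_pow[OF assms(4)] by blast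
  then obtain k :: nat where "y [^] i = y [^] k"
    using generate_pow_on_finite_carrier[OF assms(1,4)] by blast
  then show ?thesis
    using group_commutes_pow[of y x k] assms by simp
qed

text \<open>If two odd primes \<open>p\<close>, \<open>q\<close> divided the order of \<open>x\<close>, then \<open>v\<close> would commute with a power \<open>y\<close> of
  \<open>x\<close> of order \<open>pq\<close>, and the cyclic group generated by \<open>vy\<close> would contain a non-isolated
  vertex of even order \<open>2p\<close>.\<close>

lemma dominating_vertex_even_ord:
  assumes fin: "finite (carrier G)" and dom: "dominating_vertex (difference_graph G) v"
    and x: "x \<in> carrier G" and p: "prime p" "p dvd ord x" and q: "prime q" "q dvd ord x"
    and pq: "p \<noteq> q"
  shows "even (ord x)"
proof (rule ccontr)
  assume odd: "odd (ord x)"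
  note v = dominating_vertex_involution[OF fin dom]
  have odd': "odd p" "odd q"
    using odd p q by auto
  have co: "coprime p q"
    using p q pq by (simp add: primes_coprime)
  define y where "y = x [^] (ord x div (p * q))"
  have y: "y \<in> carrier G" and oy: "ord y = p * q"
    using x ord_pow_div[OF fin x, of "p * q"] divides_mult[OF p(2) q(2) co] by (auto simp: y_def)
  have inc: "\<not> p dvd q" "\<not> q dvd p"
    using p q pq primes_dvd_imp_eq by auto
  let ?a = "y [^] q" and ?b = "y [^] p"
  have div: "p * q div p = q" "p * q div q = p"
    using p q by (auto simp: prime_gt_0_nat)
  have oab: "ord ?a = p" "ord ?b = q"
    using ord_pow_div[OF fin y, of p] ord_pow_div[OF fin y, of q] by (simp_all add: oy div)
  have arc: "(?a, ?b) \<in> parcs (difference_graph G)" "(?b, ?a) \<in> parcs (difference_graph G)"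
    using difference_graph_arc_powers[OF fin y, of p q]
      difference_graph_arc_powers[OF fin y, of q p] inc by (simp_all add: oy div)
  \<comment> \<open>Adjacency puts \<open>v\<close> and \<open>w\<close> into a common cyclic group.
    As \<open>y\<close> is not known to be a vertex, this is applied to its powers \<open>?a\<close>
    and \<open>?b\<close>, from which a Bezout identity recovers \<open>y\<close>.\<close>
  have comm: "v \<otimes> w = w \<otimes> v" if "(w, u) \<in> parcs (difference_graph G)" "w \<noteq> v" for w u
  proof -
    have "(v, w) \<in> parcs (difference_graph G)"
      using dom that difference_graph_vertex_iff[OF fin] by (auto simp: dominating_vertex_def)
    then show ?thesis
      unfolding difference_graph_arc_iff[OF fin] using cyclic_commute[OF fin] by blast
  qed
  have va: "v \<otimes> ?a = ?a \<otimes> v" and vb: "v \<otimes> ?b = ?b \<otimes> v"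
    using comm arc oab v odd' by auto
  obtain s t :: int where st: "s * int p + t * int q = 1"
    using bezout_int[of "int p" "int q"] co by auto
  have y_eq: "y = ?b [^] s \<otimes> ?a [^] t"
  proof -
    have "?b [^] s \<otimes> ?a [^] t = y [^] (int p * s + int q * t)"
      using y by (simp add: int_pow_int[symmetric] int_pow_pow int_pow_mult)
    then show ?thesis
      using st y by (simp add: mult.commute)
  qed
  have vy: "v \<otimes> y = y \<otimes> v"
  proof -
    have "v \<otimes> (?b [^] s \<otimes> ?a [^] t) = (?b [^] s \<otimes> ?a [^] t) \<otimes> v"
      using commute_int_pow[OF fin va, of t] commute_int_pow[OF fin vb, of s] v(1) y
      by (metis int_pow_closed m_assoc nat_pow_closed)
    then show ?thesis
      using y_eq by simp
  qed
  define z where "z = v \<otimes> y"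
  have z: "z \<in> carrier G"
    using v y by (simp add: z_def)
  have zn: "z [^] n = v [^] n \<otimes> y [^] n" for n :: nat
    using pow_mult_distrib[OF vy v(1) y] by (simp add: z_def)
  \<comment> \<open>The odd exponent \<open>p * q\<close> kills the factor \<open>y\<close> and
    keeps the involution \<open>v\<close>, so \<open>ord z\<close> is even.\<close>
  have "z [^] (p * q) = v"
  proof -
    obtain k where k: "p * q = 2 * k + 1"
      using odd' even_mult_iff oddE by metis
    have "v [^] (p * q) = v"
      using v pow_ord_eq_1[OF v(1)] by (simp add: k nat_pow_mult[symmetric] nat_pow_pow[symmetric])
    moreover have "y [^] (p * q) = \<one>"
      using pow_ord_eq_1[OF y] oy by simp
    ultimately show ?thesis
      using zn v by simp
  qed
  then have two: "2 dvd ord z"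
    using ord_dvd_if_mem_generate[OF z nat_pow_mem_generate[OF z, of "p * q"]] v by simp
  \<comment> \<open>Squaring kills \<open>v\<close> and, the order of \<open>y\<close> being odd,
    preserves that order; hence \<open>p * q\<close> divides \<open>ord z\<close>.\<close>
  have "z [^] (2::nat) = y [^] (2::nat)"
    using zn[of 2] pow_ord_eq_1[OF v(1)] v(2) y by simp
  moreover have "ord (y [^] (2::nat)) = p * q"
    using pow_ord_eq_ord_iff[OF fin y, of 2] odd' oy by simp
  ultimately have pqz: "p * q dvd ord z"
    using ord_dvd_if_mem_generate[OF z nat_pow_mem_generate[OF z, of 2]] by simp
  have "2 * p dvd ord z" "q dvd ord z"
    using two pqz odd' by (auto intro: divides_mult dvd_trans[OF _ pqz])
  moreover have "\<not> q dvd 2 * p"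
    using inc odd' q by (metis prime_dvd_mult_iff primes_dvd_imp_eq two_is_prime_nat even_numeral)
  moreover have "\<not> 2 * p dvd q"
    using odd' by (meson dvd_mult_left)
  ultimately have "2 * p = 2"
    using dominating_vertex_even_divisor(1)[OF fin dom z, of "2 * p" q] by simp
  then show False
    using p by simp
qed

text \<open>Evenness gives \<open>2 * p\<close> as a divisor of the order for some odd prime
  \<open>p\<close>. A further prime factor \<open>r\<close> would create an incomparable pair whose
  even member is not 2: 4 and \<open>p\<close> if \<open>r\<close> is 2, \<open>2 * p\<close> and
  \<open>p * p\<close> if \<open>r\<close> is \<open>p\<close>, and \<open>2 * p\<close> and
  \<open>r\<close> otherwise.\<close>

lemma dominating_vertex_ord:
  assumes fin: "finite (carrier G)" and dom: "dominating_vertex (difference_graph G) v"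
    and x: "x \<in> carrier G" and np: "\<nexists>p k. prime p \<and> ord x = p ^ k"
  obtains p where "prime p" "p > 2" "ord x = 2 * p" "x [^] p = v"
proof -
  have pos: "ord x > 0"
    using ord_ge_1[OF fin x] by simp
  obtain r q where rq: "prime r" "prime q" "r \<noteq> q" "r dvd ord x" "q dvd ord x"
    using not_prime_power_imp_two_primes[OF pos np] by blast
  have ev: "even (ord x)"
    using dominating_vertex_even_ord[OF fin dom x rq(1,4,2,5,3)] .
  have "\<exists>p. prime p \<and> p dvd ord x \<and> p \<noteq> 2"
    using rq by metis
  then obtain p where p: "prime p" "p dvd ord x" "p \<noteq> 2"
    by blast
  have p2: "p > 2"
    using p prime_ge_2_nat[of p] by simp
  have oddp: "odd p"
    using p by (simp add: p2 prime_odd_nat)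
  note E = dominating_vertex_even_divisor[OF fin dom x]
  have d: "2 * p dvd ord x"
    using ev p oddp by (auto intro: divides_mult)
  have eq: "ord x = 2 * p"
  proof (rule ccontr)
    assume "ord x \<noteq> 2 * p"
    then obtain m where m: "ord x = 2 * p * m" "m \<noteq> 1"
      using d by (auto elim: dvdE)
    then obtain r where r: "prime r" "r dvd m"
      using prime_factor_nat by blast
    have dr: "2 * p * r dvd ord x"
      using m r by simp
    consider "r = 2" | "r = p" | "r \<noteq> 2" "r \<noteq> p" by blast
    then show False
    proof cases
      case 1
      have "4 dvd ord x"
        using dr 1 by (auto intro: dvd_trans[of _ "2 * p * r"])
      moreover have "\<not> p dvd 4"
        using p prime_dvd_power[of p 2 2] primes_dvd_imp_eq[of p 2] by auto
      moreover have "\<not> 4 dvd p"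
        using oddp by (meson dvd_trans even_numeral)
      ultimately show False
        using E(1)[of 4 p] p by simp
    next
      case 2
      have "p * p dvd ord x"
        using dr 2 by (auto intro: dvd_trans[of _ "2 * p * r"])
      moreover have "\<not> 2 * p dvd p * p" "\<not> p * p dvd 2 * p"
        using oddp p p2 primes_dvd_imp_eq[of p 2] by auto
      ultimately show False
        using E(1)[of "2 * p" "p * p"] d p2 by simp
    next
      case 3
      have "r dvd ord x"
        using dr dvd_mult_right by blast
      moreover have "\<not> 2 * p dvd r"
        using 3 r p primes_dvd_imp_eq[of p r] dvd_mult_right by blast
      moreover have "\<not> r dvd 2 * p"
        using 3 r p by (metis prime_dvd_mult_iff primes_dvd_imp_eq two_is_prime_nat)
      ultimately show False
        using E(1)[of "2 * p" r] d p2 by simp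
    qed
  qed
  have "\<not> p dvd 2" "\<not> 2 dvd p"
    using oddp p primes_dvd_imp_eq[of p 2] by auto
  then have "x [^] p = v"
    using E(2)[of 2 p] eq by simp
  then show thesis
    using that p p2 eq by blast
qed

section \<open>From a dominating vertex to condition B\<close>

lemma dominatable_imp_condition_B:
  assumes fin: "finite (carrier G)" and nE: "\<not> EPPO_group G"
    and "dominatable (difference_graph G)"
  shows "condition_B G"
proof -
  obtain v where dom: "dominating_vertex (difference_graph G) v"
    using assms(3) by (auto simp: dominatable_def)
  note v = dominating_vertex_involution[OF fin dom]
  have not_pp: "\<nexists>r k. prime r \<and> 2 * p = r ^ k" if "prime p" "p > 2" for p :: nat
  proof
    assume "\<exists>r k. prime r \<and> 2 * p = r ^ k"
    then obtain r k where "prime r" "2 * p = r ^ k" by blast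
    then have "2 dvd p \<or> p dvd 2"
      by (rule dvd_comparable_prime_power) simp_all
    then show False
      using that primes_dvd_imp_eq[of 2 p] primes_dvd_imp_eq[of p 2] by auto
  qed
  \<comment> \<open>Since 2 and \<open>p\<close> are incomparable divisors of \<open>2 * p\<close>,
    the order of \<open>z\<close> is no prime power and the preceding classification
    applies.\<close>
  have pow_v: "z [^] p = v" if z: "z \<in> carrier G" and p: "prime p" "p > 2" "ord z = 2 * p" for z p
  proof -
    have "\<nexists>r k. prime r \<and> ord z = r ^ k"
      using not_pp p by simp
    then obtain q where "ord z = 2 * q" "z [^] q = v"
      by (rule dominating_vertex_ord[OF fin dom z])
    then show ?thesis
      using p by simp
  qed
  \<comment> \<open>Only primes realised by an element of order \<open>2 * p\<close> are taken,
    which makes \<open>P\<close> finite; it is nonempty because some element has an order that is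
    not a prime power.\<close>
  define P where "P = {p. prime p \<and> p > 2 \<and> (\<exists>x\<in>carrier G. ord x = 2 * p)}"
  have "P \<subseteq> (\<lambda>x. ord x div 2) ` carrier G"
  proof
    fix p
    assume "p \<in> P"
    then obtain x where "x \<in> carrier G" "ord x = 2 * p"
      by (auto simp: P_def)
    then show "p \<in> (\<lambda>x. ord x div 2) ` carrier G"
      by (intro image_eqI[of _ _ x]) simp_all
  qed
  then have finP: "finite P"
    using fin finite_surj by blast
  have neP: "P \<noteq> {}"
  proof -
    obtain x where x: "x \<in> carrier G" "\<nexists>p k. prime p \<and> ord x = p ^ k"
      using nE fin is_group by (auto simp: EPPO_group_def)
    then show ?thesis
      by (rule dominating_vertex_ord[OF fin dom]) (use x in \<open>auto simp: P_def\<close>)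
  qed
  have ords: "ord x = 1 \<or> (\<exists>p\<in>P. ord x = 2 * p) \<or> (\<exists>p k. prime p \<and> ord x = p ^ k)"
    if x: "x \<in> carrier G" for x
  proof (cases "\<exists>p k. prime p \<and> ord x = p ^ k")
    case False
    obtain p where "prime p" "p > 2" "ord x = 2 * p"
      by (rule dominating_vertex_ord[OF fin dom x False])
    then show ?thesis
      using x by (auto simp: P_def)
  qed simp
  have inter: "card (H \<inter> K) = 2"
    if pq: "p \<in> P" "q \<in> P" and H: "cyclic_subgroup G H" "card H = 2 * p"
      and K: "cyclic_subgroup G K" "card K = 2 * q" and HK: "H \<noteq> K" for p q H K
  proof -
    obtain x where x: "x \<in> carrier G" "H = generate G {x}"
      using H by (auto simp: cyclic_subgroup_def)
    obtain y where y: "y \<in> carrier G" "K = generate G {y}"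
      using K by (auto simp: cyclic_subgroup_def)
    have o: "ord x = 2 * p" "ord y = 2 * q"
      using H K x y generate_pow_card by auto
    have pr: "prime p" "p > 2" "prime q" "q > 2"
      using pq by (auto simp: P_def)
    have xp: "x [^] p = v"
      using pow_v[OF x(1)] o pr by simp
    have yq: "y [^] q = v"
      using pow_v[OF y(1)] o pr by simp
    have vH: "v \<in> H" "v \<in> K"
      using nat_pow_mem_generate[OF x(1), of p] nat_pow_mem_generate[OF y(1), of q] x y xp yq
      by simp_all
    have subK: "subgroup K G"
      using y generate_is_subgroup by simp
    have "w = \<one> \<or> w = v" if w: "w \<in> H" "w \<in> K" for w
    \<comment> \<open>If \<open>p\<close> divides \<open>ord w\<close>, then \<open>w\<close>
      generates the square of \<open>x\<close>, which together with \<open>v\<close> recovers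
      \<open>x\<close>; so \<open>H\<close> lies in \<open>K\<close>, and equal cardinalities
      contradict \<open>HK\<close>. Otherwise \<open>ord w\<close> divides 2.\<close>
    proof (cases "p dvd ord w")
      case True
      have "ord w dvd 2 * q"
        using ord_dvd_if_mem_generate[OF y(1), of w] w y o by simp
      then have "p dvd 2 * q"
        using True dvd_trans by blast
      then have pq_eq: "p = q"
        using pr by (metis prime_dvd_mult_iff primes_dvd_imp_eq two_is_prime_nat less_irrefl)
      have "ord (x [^] (2::nat)) = p"
        using ord_pow[OF x(1), of 2] o by simp
      then have "x [^] (2::nat) \<in> generate G {w}"
        using mem_generate_if_ord_dvd[OF fin x(1) nat_pow_mem_generate[OF x(1), of 2], of w] True w x
        by simp
      then have x2: "x [^] (2::nat) \<in> K"
        using generate_subgroup_incl[OF _ subK, of "{w}"] w by auto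
      have "odd p"
        using pr by (simp add: prime_odd_nat)
      then obtain k where k: "p = 2 * k + 1"
        by (rule oddE)
      \<comment> \<open>The exponent \<open>k + 1\<close> is chosen so that the total
        \<open>p + 2 * (k + 1)\<close> is \<open>2 * p + 1\<close>, one more than the order of
        \<open>x\<close>.\<close>
      have "v \<otimes> (x [^] (2::nat)) [^] (k + 1) = x [^] (p + 2 * (k + 1))"
        by (simp only: xp[symmetric] nat_pow_pow[OF x(1)] nat_pow_mult[OF x(1)])
      also have "p + 2 * (k + 1) = 2 * p + 1"
        using k by simp
      also have "x [^] (2 * p + 1) = x"
        using x(1) pow_ord_eq_1[OF x(1)] o by simp
      finally have x_eq: "v \<otimes> (x [^] (2::nat)) [^] (k + 1) = x" .
      have "(x [^] (2::nat)) [^] (k + 1) \<in> K"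
        using generate_subgroup_incl[OF _ subK, of "{x [^] (2::nat)}"] x2 x(1)
          nat_pow_mem_generate[of "x [^] (2::nat)" "k + 1"] by blast
      then have "x \<in> K"
        using subgroup.m_closed[OF subK vH(2)] x_eq by force
      then have "H \<subseteq> K"
        using generate_subgroup_incl[OF _ subK, of "{x}"] x by auto
      moreover have "finite K"
        using subK fin finite_subset subgroup.subset by blast
      ultimately show ?thesis
        using card_subset_eq[of K H] H K pq_eq HK by simp
    next
      case False
      have wc: "w \<in> carrier G"
        using w x generate_in_carrier[of "{x}"] by auto
      have "ord w dvd 2 * p"
        using ord_dvd_if_mem_generate[OF x(1), of w] w x o by simp
      moreover have "coprime (ord w) p"
        using False pr by (simp add: prime_imp_coprime coprime_commute)
      ultimately have "ord w dvd 2"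
        using coprime_dvd_mult_left_iff by blast
      then have "ord w = 1 \<or> ord w = 2"
        using two_is_prime_nat by (auto simp: prime_nat_iff)
      then show ?thesis
        using ord_eq_1[OF wc] cyclic_unique_involution[OF fin x(1), of w v] w vH x v by auto
    qed
    moreover have "\<one> \<in> H" "\<one> \<in> K" "\<one> \<noteq> v"
      using x y v by (auto intro: generate.one)
    ultimately have "H \<inter> K = {\<one>, v}"
      using vH by auto
    then show ?thesis
      using \<open>\<one> \<noteq> v\<close> by simp
  qed
  have "\<forall>p\<in>P. prime p \<and> p > 2"
    by (simp add: P_def)
  moreover have "\<forall>p\<in>P. \<forall>q\<in>P. \<forall>H K. cyclic_subgroup G H \<and> card H = 2 * p \<and>
      cyclic_subgroup G K \<and> card K = 2 * q \<and> H \<noteq> K \<longrightarrow> card (H \<inter> K) = 2"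
    using inter by blast
  ultimately show ?thesis
    unfolding condition_B_def using finP neP ords by (intro exI[of _ P] conjI) (assumption | intro ballI)+
qed

section \<open>From condition B to a star\<close>

text \<open>An intersection of cardinality 2 of two cyclic subgroups consists of the identity and an
  involution. Each cyclic group has at most one involution, so all those of order
  \<open>2 * r\<close> with \<open>r\<close> in \<open>P\<close> share the same
  \<open>v\<close>.\<close>

lemma condition_B_imp_common_involution:
  assumes fin: "finite (carrier G)" and nE: "\<not> EPPO_group G" and B: "condition_B G"
  obtains v where "v \<in> pverts (difference_graph G)"
    and "\<And>a b. (a, b) \<in> parcs (difference_graph G) \<Longrightarrow> a = v \<or> b = v"
proof -
  obtain P where P_prime: "\<forall>p\<in>P. prime p \<and> p > (2::nat)"
    and o: "\<forall>x\<in>carrier G. ord x = 1 \<or> (\<exists>p\<in>P. ord x = 2 * p) \<or>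
      (\<exists>(p::nat) \<alpha>. prime p \<and> ord x = p ^ \<alpha>)"
    and inter: "\<forall>p\<in>P. \<forall>q\<in>P. \<forall>H K. cyclic_subgroup G H \<and> card H = 2 * p \<and>
      cyclic_subgroup G K \<and> card K = 2 * q \<and> H \<noteq> K \<longrightarrow> card (H \<inter> K) = 2"
    using B unfolding condition_B_def by (elim exE conjE) (rule that, assumption+)
  note P = P_prime[rule_format]
  \<comment> \<open>Order 1 is the prime power with exponent 0, so that alternative of condition B
    is absorbed.\<close>
  have "\<exists>p (k::nat). prime p \<and> (1::nat) = p ^ k"
    by (intro exI[of _ 2] exI[of _ 0]) simp
  then have ord_P: "\<exists>p\<in>P. ord x = 2 * p"
    if "x \<in> carrier G" "\<nexists>p k. prime p \<and> ord x = p ^ k" for x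
    using bspec[OF o that(1)] that(2) by metis
  obtain x where x: "x \<in> carrier G" "\<nexists>p k. prime p \<and> ord x = p ^ k"
    using nE fin is_group by (auto simp: EPPO_group_def)
  obtain p where p: "p \<in> P" "ord x = 2 * p"
    using ord_P x by blast
  have inv2: "ord (c [^] r) = 2" if "c \<in> carrier G" "r \<in> P" "ord c = 2 * r" for c r
    using ord_pow[OF that(1), of r] that(3) P[OF that(2)] by simp
  define v where "v = x [^] p"
  have v: "ord v = 2" "v \<in> generate G {x}"
    using inv2 x p nat_pow_mem_generate by (auto simp: v_def)
  have common: "v \<in> generate G {c}" if c: "c \<in> carrier G" and r: "r \<in> P" "ord c = 2 * r" for c r
  proof (cases "generate G {c} = generate G {x}")
    case False
    let ?I = "generate G {c} \<inter> generate G {x}"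
    have "card ?I = 2"
      using False c x p r
      by (intro inter[rule_format, of r p])
        (auto simp: cyclic_subgroup_def generate_pow_card[symmetric])
    moreover have "\<one> \<in> ?I"
      by (simp add: generate.one)
    ultimately obtain w where w: "?I = {\<one>, w}" "w \<noteq> \<one>"
      by (rule card_2_other_element)
    have wI: "w \<in> ?I"
      using w by simp
    then have wc: "w \<in> carrier G"
      using generate_in_carrier[of "{c}"] c by auto
    \<comment> \<open>The product is the identity or \<open>w\<close>, and the latter would make
      \<open>w\<close> trivial.\<close>
    have "w \<otimes> w \<in> ?I"
      using wI by (auto intro: generate.eng)
    then have "w [^] (2::nat) = \<one>"
      using w wc by (auto simp: numeral_2_eq_2)
    then have "ord w dvd 2"
      using pow_eq_id[OF wc] by simp
    then have "ord w = 2"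
      using w ord_eq_1[OF wc] two_is_prime_nat by (auto simp: prime_nat_iff)
    then show ?thesis
      using cyclic_unique_involution[OF fin x(1)] v wI by blast
  qed (use v in simp)
  have cover: "a = v \<or> b = v" if arc: "(a, b) \<in> parcs (difference_graph G)" for a b
  proof -
    obtain c where c: "c \<in> carrier G" "a \<in> generate G {c}" "b \<in> generate G {c}"
      and ab: "\<not> ord a dvd ord b" "\<not> ord b dvd ord a"
      using arc unfolding difference_graph_arc_iff[OF fin] by blast
    have dvd: "ord a dvd ord c" "ord b dvd ord c"
      using c ord_dvd_if_mem_generate by auto
    then have "\<nexists>p k. prime p \<and> ord c = p ^ k"
      using ab dvd_comparable_prime_power by blast
    then obtain r where r: "r \<in> P" "ord c = 2 * r"
      using ord_P c by blast
    then have "ord a = 2 \<or> ord b = 2"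
      using dvd ab P dvd_two_times_prime_incomparable by metis
    then show ?thesis
      using cyclic_unique_involution[OF fin c(1)] c common[OF c(1) r] v by blast
  qed
  have "v \<in> pverts (difference_graph G)"
  proof -
    \<comment> \<open>The square of \<open>x\<close> has order \<open>p\<close>, incomparable to 2,
      and serves as a neighbour of \<open>v\<close>.\<close>
    have "\<not> p dvd 2" "\<not> 2 dvd p"
      using P[OF p(1)] primes_dvd_imp_eq[of p 2] primes_dvd_imp_eq[of 2 p] by auto
    then have "(v, x [^] (2::nat)) \<in> parcs (difference_graph G)"
      using difference_graph_arc_powers[OF fin x(1), of 2 p] p P[OF p(1)] by (simp add: v_def)
    then show ?thesis
      using difference_graph_vertex_iff[OF fin] by blast
  qed
  then show thesis
    using cover by (rule that)
qed

text \<open>With isolated vertices removed, every vertex other than \<open>v\<close> has an arc and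
  hence is a neighbour of \<open>v\<close>. The parts are \<open>{v}\<close> and its neighbourhood
  \<open>W\<close>, which is nonempty because \<open>v\<close> itself is not isolated.\<close>

lemma star_graph_difference_graphI:
  assumes fin: "finite (carrier G)" and v: "v \<in> pverts (difference_graph G)"
    and cover: "\<And>a b. (a, b) \<in> parcs (difference_graph G) \<Longrightarrow> a = v \<or> b = v"
  shows "star_graph (difference_graph G)"
proof -
  let ?D = "difference_graph G"
  define W where "W = {w. (v, w) \<in> parcs ?D}"
  have "v \<notin> W"
    using difference_graph_arc_iff[OF fin] by (simp add: W_def)
  have arcs: "parcs ?D = {v} \<times> W \<union> W \<times> {v}"
    using cover difference_graph_arc_sym[OF fin] by (auto simp: W_def)
  have verts: "pverts ?D = {v} \<union> W"
    using v difference_graph_vertex_iff[OF fin] arcs by auto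
  have "pverts ?D \<subseteq> carrier G"
    by (auto simp: difference_graph_def remove_isolated_def)
  then have finD: "finite (pverts ?D)"
    using fin finite_subset by blast
  moreover have "W \<noteq> {}"
    using v difference_graph_vertex_iff[OF fin] by (auto simp: W_def)
  ultimately have "card W \<ge> 1"
    by (simp add: verts Suc_le_eq card_gt_0_iff)
  moreover have "complete_bipartite_digraph 1 (card W) (with_proj ?D)"
    unfolding complete_bipartite_digraph_pair_def
    using finD verts arcs \<open>v \<notin> W\<close> by (intro conjI, simp, intro exI[of _ "{v}"] exI[of _ W], simp)
  ultimately show ?thesis
    by (auto simp: star_graph_def)
qed

end

lemma star_graph_imp_dominatable:
  assumes "star_graph H"
  shows "dominatable H"
proof -
  obtain U V where "pverts H = U \<union> V" "parcs H = U \<times> V \<union> V \<times> U" "card U = 1"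
    using assms unfolding star_graph_def complete_bipartite_digraph_pair_def by blast
  moreover from this obtain u where "U = {u}"
    by (auto simp: card_1_singleton_iff)
  ultimately have "dominating_vertex H u"
    by (auto simp: dominating_vertex_def)
  then show ?thesis
    by (auto simp: dominatable_def)
qed

theorem theorem3p10:
  fixes G :: "('a, 'b) monoid_scheme"
  assumes "group G" and "finite (carrier G)" and "\<not> EPPO_group G"
  shows "(star_graph (difference_graph G) \<longleftrightarrow> dominatable (difference_graph G)) \<and>
         (dominatable (difference_graph G) \<longleftrightarrow> condition_B G)"
proof -
  interpret group G by fact
  \<comment> \<open>This implication closes the cycle: a star is dominatable, and dominatability
    yields condition B.\<close>
  have "star_graph (difference_graph G)" if B: "condition_B G"
  proof (rule condition_B_imp_common_involution[OF assms(2,3) B])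
    fix v
    assume "v \<in> pverts (difference_graph G)"
      and "\<And>a b. (a, b) \<in> parcs (difference_graph G) \<Longrightarrow> a = v \<or> b = v"
    then show ?thesis
      by (rule star_graph_difference_graphI[OF assms(2)])
  qed
  then show ?thesis
    using star_graph_imp_dominatable dominatable_imp_condition_B[OF assms(2,3)] by blast
qed

end
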